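(* If $A$ is a C$^*$-algebra of real rank zero then $\mathcal{P}(A)$ is separative; that is, whenever $P,Q\in\mathcal{P}(A)$ and $P\nleq Q$, there exists a non-zero $R\in\mathcal{P}(A)$ with $R\leq P$ such that the greatest lower bound of $R$ and $Q$ in $\mathcal{P}(A)$ is $0$ (i.e. $0$ is the only element of $\mathcal{P}(A)$ below both $R$ and $Q$).
   Context: C$^*$-algebras are over the scalar field $\mathbb{F}=\mathbb{R}$ or $\mathbb{C}$ and are (isomorphic to) norm-closed self-adjoint subalgebras of $\mathcal{B}(H)$ for some Hilbert space $H$ over $\mathbb{F}$. $\mathcal{P}(A)$ is the set of projections (self-adjoint idempotents) of $A$, ordered by $P\leq Q\Leftrightarrow PQ=P$. $A$ has real rank zero if the invertible self-adjoint elements are dense in the self-adjoint elements of $A$ (of $A$ with a unit adjoined, if $A$ has none). *)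

theory Defs
  imports "HOL-Analysis.Analysis"
begin

text \<open>
  The scalar fields: the last two axioms say that every \<open>x\<close> is a root of the real quadratic
  \<open>t\<^sup>2 - 2 re(x) t + |x|\<^sup>2\<close>, so up to isomorphism the instances are exactly the reals (with
  trivial conjugation) and the complex numbers (with complex conjugation).
\<close>

class real_or_complex = real_normed_field +
  fixes conjugate :: "'a \<Rightarrow> 'a"
    and re_part :: "'a \<Rightarrow> real"
  assumes conjugate_add: "conjugate (x + y) = conjugate x + conjugate y"
    and conjugate_mult: "conjugate (x * y) = conjugate x * conjugate y"
    and add_conjugate_scaleR: "x + conjugate x = (2 * re_part x) *\<^sub>R 1"
    and mult_conjugate_scaleR: "x * conjugate x = (norm x)\<^sup>2 *\<^sub>R 1"

lemma add_conjugate: "x + conjugate x = of_real (2 * re_part x)"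
  by (simp add: add_conjugate_scaleR of_real_def)

lemma mult_conjugate: "x * conjugate x = of_real ((norm x)\<^sup>2)"
  by (simp add: mult_conjugate_scaleR of_real_def)

instantiation real :: real_or_complex
begin

definition conjugate_real :: "real \<Rightarrow> real" where "conjugate_real x = x"
definition re_part_real :: "real \<Rightarrow> real" where "re_part_real x = x"

instance
  by standard (auto simp: conjugate_real_def re_part_real_def power2_eq_square)

end

instantiation complex :: real_or_complex
begin

definition conjugate_complex :: "complex \<Rightarrow> complex" where "conjugate_complex = cnj"
definition re_part_complex :: "complex \<Rightarrow> real" where "re_part_complex = Re"

instance
  by standard (auto simp: conjugate_complex_def re_part_complex_def complex_add_cnj
      complex_norm_square scaleR_conv_of_real simp del: of_real_power)

end

text \<open>
  A Hilbert space over \<open>'f\<close> is presented as its underlying real Hilbert space \<open>'h\<close>, together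
  with the multiplication by scalars from \<open>'f\<close> and the \<open>'f\<close>-valued inner product, whose real part
  is the inner product of \<open>'h\<close>. Since \<open>ip x x = of_real (x \<bullet> x)\<close>, both inner products
  induce the same norm.
\<close>

locale hilbert_space = vector_space smul
  for smul :: "'f::real_or_complex \<Rightarrow> 'h::{real_inner, complete_space} \<Rightarrow> 'h" +
  fixes ip :: "'h \<Rightarrow> 'h \<Rightarrow> 'f"
  assumes smul_of_real: "smul (of_real r) x = r *\<^sub>R x"
    and ip_add_left: "ip (x + y) z = ip x z + ip y z"
    and ip_smul_left: "ip (smul c x) y = c * ip x y"
    and ip_commute: "ip y x = conjugate (ip x y)"
    and re_ip: "re_part (ip x y) = x \<bullet> y"

text \<open>
  Bounded operators on \<open>H\<close>: the elements of \<open>'h \<Rightarrow>\<^sub>L 'h\<close>, which are only real linear,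
  that are linear over \<open>'f\<close>.
\<close>

definition operators :: "('f \<Rightarrow> 'h::real_normed_vector \<Rightarrow> 'h) \<Rightarrow> ('h \<Rightarrow>\<^sub>L 'h) set" where
  "operators smul = {T. \<forall>c x. blinfun_apply T (smul c x) = smul c (blinfun_apply T x)}"

definition op_scale ::
  "('f \<Rightarrow> 'h \<Rightarrow> 'h) \<Rightarrow> 'f \<Rightarrow> ('h::real_normed_vector \<Rightarrow>\<^sub>L 'h) \<Rightarrow> ('h \<Rightarrow>\<^sub>L 'h)" where
  "op_scale smul c T = Blinfun (\<lambda>x. smul c (blinfun_apply T x))"

definition is_adjoint ::
  "('h \<Rightarrow> 'h \<Rightarrow> 'f) \<Rightarrow> ('h::real_normed_vector \<Rightarrow>\<^sub>L 'h) \<Rightarrow> ('h \<Rightarrow>\<^sub>L 'h) \<Rightarrow> bool" where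
  "is_adjoint ip T S \<longleftrightarrow> (\<forall>x y. ip (blinfun_apply T x) y = ip x (blinfun_apply S y))"

definition selfadjoint_elements ::
  "('h \<Rightarrow> 'h \<Rightarrow> 'f) \<Rightarrow> ('h::real_normed_vector \<Rightarrow>\<^sub>L 'h) set \<Rightarrow> ('h \<Rightarrow>\<^sub>L 'h) set" where
  "selfadjoint_elements ip A = {T \<in> A. is_adjoint ip T T}"

definition cstar_algebra ::
  "('f \<Rightarrow> 'h \<Rightarrow> 'h) \<Rightarrow> ('h \<Rightarrow> 'h \<Rightarrow> 'f) \<Rightarrow> ('h::real_normed_vector \<Rightarrow>\<^sub>L 'h) set \<Rightarrow> bool" where
  "cstar_algebra smul ip A \<longleftrightarrow>
     A \<subseteq> operators smul \<and> closed A \<and> 0 \<in> A \<and>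
     (\<forall>S\<in>A. \<forall>T\<in>A. S + T \<in> A \<and> S o\<^sub>L T \<in> A) \<and>
     (\<forall>c. \<forall>T\<in>A. op_scale smul c T \<in> A) \<and>
     (\<forall>T\<in>A. \<exists>S\<in>A. is_adjoint ip T S)"

text \<open>The unit of \<open>A\<close> need not be the identity operator.\<close>

definition is_unit_of :: "('h::real_normed_vector \<Rightarrow>\<^sub>L 'h) set \<Rightarrow> ('h \<Rightarrow>\<^sub>L 'h) \<Rightarrow> bool" where
  "is_unit_of A E \<longleftrightarrow> E \<in> A \<and> (\<forall>T\<in>A. E o\<^sub>L T = T \<and> T o\<^sub>L E = T)"

definition unitization ::
  "('f \<Rightarrow> 'h \<Rightarrow> 'h) \<Rightarrow> ('h::real_normed_vector \<Rightarrow>\<^sub>L 'h) set \<Rightarrow> ('h \<Rightarrow>\<^sub>L 'h) set" where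
  "unitization smul A =
     (if \<exists>E. is_unit_of A E then A
      else {T + op_scale smul c id_blinfun | T c. T \<in> A})"

definition invertible_elements ::
  "('h::real_normed_vector \<Rightarrow>\<^sub>L 'h) set \<Rightarrow> ('h \<Rightarrow>\<^sub>L 'h) set" where
  "invertible_elements A =
     {T \<in> A. \<exists>E. is_unit_of A E \<and> (\<exists>S\<in>A. S o\<^sub>L T = E \<and> T o\<^sub>L S = E)}"

definition real_rank_zero ::
  "('f \<Rightarrow> 'h \<Rightarrow> 'h) \<Rightarrow> ('h \<Rightarrow> 'h \<Rightarrow> 'f) \<Rightarrow> ('h::real_normed_vector \<Rightarrow>\<^sub>L 'h) set \<Rightarrow> bool" where
  "real_rank_zero smul ip A \<longleftrightarrow>
     (let B = unitization smul A
      in selfadjoint_elements ip B \<subseteq>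
           closure (invertible_elements B \<inter> selfadjoint_elements ip B))"

definition projections ::
  "('h \<Rightarrow> 'h \<Rightarrow> 'f) \<Rightarrow> ('h::real_normed_vector \<Rightarrow>\<^sub>L 'h) set \<Rightarrow> ('h \<Rightarrow>\<^sub>L 'h) set" where
  "projections ip A = {P \<in> selfadjoint_elements ip A. P o\<^sub>L P = P}"

definition proj_le :: "('h::real_normed_vector \<Rightarrow>\<^sub>L 'h) \<Rightarrow> ('h \<Rightarrow>\<^sub>L 'h) \<Rightarrow> bool" where
  "proj_le P Q \<longleftrightarrow> P o\<^sub>L Q = P"

definition is_proj_glb ::
  "('h \<Rightarrow> 'h \<Rightarrow> 'f) \<Rightarrow> ('h::real_normed_vector \<Rightarrow>\<^sub>L 'h) set \<Rightarrow>
    ('h \<Rightarrow>\<^sub>L 'h) \<Rightarrow> ('h \<Rightarrow>\<^sub>L 'h) \<Rightarrow> ('h \<Rightarrow>\<^sub>L 'h) \<Rightarrow> bool" where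
  "is_proj_glb ip A R Q G \<longleftrightarrow>
     G \<in> projections ip A \<and> proj_le G R \<and> proj_le G Q \<and>
     (\<forall>S\<in>projections ip A. proj_le S R \<and> proj_le S Q \<longrightarrow> proj_le S G)"

definition separative_projections ::
  "('h \<Rightarrow> 'h \<Rightarrow> 'f) \<Rightarrow> ('h::real_normed_vector \<Rightarrow>\<^sub>L 'h) set \<Rightarrow> bool" where
  "separative_projections ip A \<longleftrightarrow>
     (\<forall>P\<in>projections ip A. \<forall>Q\<in>projections ip A. \<not> proj_le P Q \<longrightarrow>
        (\<exists>R\<in>projections ip A. R \<noteq> 0 \<and> proj_le R P \<and> is_proj_glb ip A R Q 0))"

context hilbert_space
begin

lemma ip_self: "ip x x = of_real ((norm x)\<^sup>2)"
proof -
  have "ip x x + ip x x = of_real (2 * re_part (ip x x))"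
    using add_conjugate[of "ip x x"] ip_commute[of x x] by simp
  then have "2 * ip x x = 2 * of_real ((norm x)\<^sup>2)"
    by (simp add: re_ip power2_norm_eq_inner del: of_real_power)
  then show ?thesis by simp
qed

lemma norm_smul: "norm (smul c x) = norm c * norm x"
proof -
  have "of_real ((norm (smul c x))\<^sup>2) = ip (smul c x) (smul c x)"
    by (simp only: ip_self)
  also have "\<dots> = c * conjugate (c * ip x x)"
    by (metis ip_commute ip_smul_left)
  also have "\<dots> = (c * conjugate c) * ip x x"
    by (metis conjugate_mult ip_commute mult.assoc)
  also have "\<dots> = of_real ((norm c * norm x)\<^sup>2)"
    by (simp add: mult_conjugate ip_self power_mult_distrib)
  finally have "(norm (smul c x))\<^sup>2 = (norm c * norm x)\<^sup>2"
    by (simp only: of_real_eq_iff)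
  then show ?thesis by simp
qed

lemma blinfun_apply_op_scale [simp]:
  "blinfun_apply (op_scale smul c T) x = smul c (blinfun_apply T x)"
proof -
  have "bounded_linear (smul c)"
  proof (rule bounded_linear_intro[where K = "norm c"])
    show "smul c (r *\<^sub>R x) = r *\<^sub>R smul c x" for r x
      by (metis smul_of_real scale_left_commute)
  qed (simp_all add: scale_right_distrib norm_smul)
  then have "bounded_linear (\<lambda>x. smul c (blinfun_apply T x))"
    by (rule bounded_linear_compose) (rule blinfun.bounded_linear_right)
  then show ?thesis
    unfolding op_scale_def by (simp add: bounded_linear_Blinfun_apply)
qed

end

text \<open>Every real Hilbert space is an instance, and so is the complex line.\<close>

lemma hilbert_space_real:
  "hilbert_space (scaleR :: real \<Rightarrow> 'h::{real_inner, complete_space} \<Rightarrow> 'h) inner"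
  by unfold_locales
    (auto simp: conjugate_real_def re_part_real_def algebra_simps inner_commute)

lemma hilbert_space_complex: "hilbert_space (*) (\<lambda>x y :: complex. x * cnj y)"
  by unfold_locales
    (auto simp: conjugate_complex_def re_part_complex_def algebra_simps inner_complex_def
      scaleR_conv_of_real)

end

theory Submission imports Defs
begin

text \<open>
  Put \<open>b = P - PQP\<close>; its quadratic form at \<open>v\<close> in the range of \<open>P\<close> is
  \<open>norm (v - Q v)\<^sup>2\<close>, so it vanishes on the common range of \<open>P\<close> and \<open>Q\<close>, and if
  \<open>P \<not>\<le> Q\<close> then it is at least \<open>\<beta> norm (v\<^sub>0)\<^sup>2 > 0\<close> at some \<open>v\<^sub>0\<close>. The
  self-adjoint element \<open>(b - (\<beta>/2) P) + (1 - P)\<close> is close to an invertible self-adjoint one,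
  whose Schur complement \<open>z\<close> is an invertible self-adjoint element of \<open>PAP\<close> close to
  \<open>b - (\<beta>/2) P\<close>. Let \<open>R \<in> PAP\<close> be the spectral projection of \<open>z\<close> for the positive
  half-line. The form of \<open>z\<close> is positive at \<open>v\<^sub>0\<close>, so \<open>R \<noteq> 0\<close>; it is nonnegative on
  the range of \<open>R\<close> and negative on nonzero common vectors of \<open>P\<close> and \<open>Q\<close>, so
  the ranges of \<open>R\<close> and \<open>Q\<close> meet only in \<open>0\<close>.
\<close>

section \<open>Operators symmetric for the real inner product\<close>

text \<open>Only the real inner product enters, so the operator theory is done over the reals; for
  \<open>'f\<close>-linear operators \<open>is_adjoint_iff\<close> identifies this with
  self-adjointness for \<open>ip\<close>.\<close>

definition symmetric_op :: "('h::real_inner \<Rightarrow>\<^sub>L 'h) \<Rightarrow> bool" where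
  "symmetric_op T \<longleftrightarrow> (\<forall>x y. blinfun_apply T x \<bullet> y = x \<bullet> blinfun_apply T y)"

lemma symmetric_opD: "symmetric_op T \<Longrightarrow> blinfun_apply T x \<bullet> y = x \<bullet> blinfun_apply T y"
  by (simp add: symmetric_op_def)

lemma closed_symmetric_op: "closed {T. symmetric_op T}"
  unfolding symmetric_op_def
  by (intro closed_Collect_all closed_Collect_eq continuous_intros)

lemma blinfun_compose_eqD:
  assumes "S o\<^sub>L T = U"
  shows "blinfun_apply S (blinfun_apply T x) = blinfun_apply U x"
  using assms by (metis blinfun_apply_blinfun_compose)

text \<open>Passing to adjoints reverses the product and fixes each of the three operators. This
  turns one-sided identities such as \<open>P o\<^sub>L z = z\<close> into their mirror
  images.\<close>

lemma symmetric_compose_swap: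
  assumes "symmetric_op S" "symmetric_op T" "symmetric_op U" "S o\<^sub>L T = U"
  shows "T o\<^sub>L S = U"
proof (rule blinfun_eqI, rule vector_eq_ldot[THEN iffD1], rule allI)
  fix x y
  have "y \<bullet> blinfun_apply T (blinfun_apply S x) = blinfun_apply S (blinfun_apply T y) \<bullet> x"
    by (simp add: symmetric_opD[OF assms(1)] symmetric_opD[OF assms(2)])
  also have "\<dots> = y \<bullet> blinfun_apply U x"
    by (simp add: blinfun_compose_eqD[OF assms(4)] symmetric_opD[OF assms(3)])
  finally show "y \<bullet> blinfun_apply (T o\<^sub>L S) x = y \<bullet> blinfun_apply U x" by simp
qed

lemma norm_symmetric_idempotent_le:
  assumes "symmetric_op P" "P o\<^sub>L P = P"
  shows "norm (blinfun_apply P v) \<le> norm v"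
proof -
  have "norm (blinfun_apply P v) * norm (blinfun_apply P v) = blinfun_apply P v \<bullet> v"
    by (simp add: symmetric_opD[OF assms(1)] blinfun_compose_eqD[OF assms(2)] inner_commute
        flip: power2_eq_square power2_norm_eq_inner)
      (simp add: power2_norm_eq_inner symmetric_opD[OF assms(1)] blinfun_compose_eqD[OF assms(2)])
  also have "\<dots> \<le> norm (blinfun_apply P v) * norm v"
    by (rule norm_cauchy_schwarz)
  finally show ?thesis
    by (cases "norm (blinfun_apply P v) = 0") auto
qed

section \<open>Completeness of operator spaces and fixed points of contractions\<close>

text \<open>
  The library's completeness of \<open>'a \<Rightarrow>\<^sub>L 'b\<close> asks for the class \<open>banach\<close>, which the sort
  \<open>{real_inner, complete_space}\<close> does not entail.
\<close>

lemma complete_blinfun_UNIV: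
  "complete (UNIV :: ('a::real_normed_vector \<Rightarrow>\<^sub>L 'b::{real_normed_vector, complete_space}) set)"
proof (rule completeI)
  fix X :: "nat \<Rightarrow> 'a \<Rightarrow>\<^sub>L 'b"
  assume X: "Cauchy X"
  have "\<exists>l. (\<lambda>n. blinfun_apply (X n) v) \<longlonglongrightarrow> l" for v
    using bounded_linear.Cauchy[OF blinfun.bounded_linear_left X] Cauchy_convergent_iff
    by (auto simp: convergent_def)
  then obtain f where f: "\<And>v. (\<lambda>n. blinfun_apply (X n) v) \<longlonglongrightarrow> f v"
    by metis
  have close: "\<exists>N. \<forall>n\<ge>N. \<forall>v. norm (blinfun_apply (X n) v - f v) \<le> e * norm v" if "e > 0" for e
  proof -
    obtain N where N: "\<And>m n. m \<ge> N \<Longrightarrow> n \<ge> N \<Longrightarrow> norm (X m - X n) < e"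
      using X \<open>e > 0\<close> unfolding Cauchy_def dist_norm by blast
    \<comment> \<open>The Cauchy estimate for \<open>X n - X m\<close> passes to the limit in
      \<open>m\<close>, with \<open>n\<close> and \<open>v\<close> fixed.\<close>
    have "norm (blinfun_apply (X n) v - f v) \<le> e * norm v" if "n \<ge> N" for n v
    proof (rule tendsto_upperbound)
      show "(\<lambda>m. norm (blinfun_apply (X n) v - blinfun_apply (X m) v))
          \<longlonglongrightarrow> norm (blinfun_apply (X n) v - f v)"
        by (intro tendsto_intros f)
      have "norm (blinfun_apply (X n) v - blinfun_apply (X m) v) \<le> e * norm v" if "m \<ge> N" for m
        using norm_blinfun[of "X n - X m" v] N[OF \<open>n \<ge> N\<close> that]
          mult_right_mono[of "norm (X n - X m)" e "norm v"]
        by (simp add: blinfun.bilinear_simps)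
      then show "\<forall>\<^sub>F m in sequentially.
          norm (blinfun_apply (X n) v - blinfun_apply (X m) v) \<le> e * norm v"
        by (auto simp: eventually_sequentially)
    qed simp
    then show ?thesis by blast
  qed
  obtain N where N: "\<And>v. norm (blinfun_apply (X N) v - f v) \<le> norm v"
    using close[of 1] by auto
  have "bounded_linear f"
  proof (rule bounded_linear_intro[where K = "norm (X N) + 1"])
    show "f (u + v) = f u + f v" for u v
    proof (rule LIMSEQ_unique[OF f])
      show "(\<lambda>n. blinfun_apply (X n) (u + v)) \<longlonglongrightarrow> f u + f v"
        unfolding blinfun.add_right by (intro tendsto_intros f)
    qed
    show "f (r *\<^sub>R v) = r *\<^sub>R f v" for r v
    proof (rule LIMSEQ_unique[OF f])
      show "(\<lambda>n. blinfun_apply (X n) (r *\<^sub>R v)) \<longlonglongrightarrow> r *\<^sub>R f v"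
        unfolding blinfun.scaleR_right by (intro tendsto_intros f)
    qed
    show "norm (f v) \<le> norm v * (norm (X N) + 1)" for v
      using N[of v] norm_blinfun[of "X N" v] norm_triangle_sub[of "f v" "blinfun_apply (X N) v"]
      by (simp add: norm_minus_commute algebra_simps)
  qed
  then have Bf: "blinfun_apply (Blinfun f) = f" by (rule bounded_linear_Blinfun_apply)
  have "X \<longlonglongrightarrow> Blinfun f"
  proof (rule LIMSEQ_I)
    fix e :: real assume "e > 0"
    then obtain N where N: "\<And>n v. n \<ge> N \<Longrightarrow> norm (blinfun_apply (X n) v - f v) \<le> e / 2 * norm v"
      using close[of "e / 2"] by auto
    have "norm (X n - Blinfun f) \<le> e / 2" if "n \<ge> N" for n
      using \<open>e > 0\<close> N[OF that] by (intro norm_blinfun_bound) (auto simp: blinfun.bilinear_simps Bf)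
    then show "\<exists>N. \<forall>n\<ge>N. norm (X n - Blinfun f) < e"
      using \<open>e > 0\<close> by (intro exI[of _ N]) fastforce
  qed
  then show "\<exists>l\<in>UNIV. X \<longlonglongrightarrow> l" by blast
qed

lemma complete_if_closed_blinfun:
  fixes V :: "('a::real_normed_vector \<Rightarrow>\<^sub>L 'b::{real_normed_vector, complete_space}) set"
  shows "closed V \<Longrightarrow> complete V"
  using complete_Int_closed[OF complete_blinfun_UNIV] by simp

text \<open>The solution is \<open>y\<close> times the Neumann series of \<open>d\<close>, that is,
  \<open>y (1 - d)\<^sup>-\<^sup>1\<close>. Obtaining it as a fixed point keeps it inside
  \<open>V\<close>, although \<open>V\<close> may contain neither \<open>d\<close> nor the
  identity.\<close>

lemma neumann_fixed_point:
  fixes d y :: "'h::{real_normed_vector, complete_space} \<Rightarrow>\<^sub>L 'h"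
  assumes "closed V" "y \<in> V" "\<And>g. g \<in> V \<Longrightarrow> y + (g o\<^sub>L d) \<in> V" "norm d < 1"
  obtains g where "g \<in> V" "g = y + (g o\<^sub>L d)"
proof -
  have "\<exists>!g\<in>V. y + (g o\<^sub>L d) = g"
  proof (rule Banach_fix[where c = "norm d"])
    show "complete V" using assms(1) by (rule complete_if_closed_blinfun)
    show "dist (y + (g o\<^sub>L d)) (y + (h o\<^sub>L d)) \<le> norm d * dist g h" for g h
    proof -
      have "(g o\<^sub>L d) - (h o\<^sub>L d) = (g - h) o\<^sub>L d"
        by (rule blinfun_eqI) (simp add: blinfun.bilinear_simps)
      then show ?thesis
        using norm_blinfun_compose[of "g - h" d] by (simp add: dist_norm mult.commute)
    qed
  qed (use assms in auto)
  then show ?thesis using that by metis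
qed

text \<open>The fixed point is \<open>1 - sqrt (1 - a)\<close>.\<close>

lemma sqrt_fixed_point:
  fixes a :: "'h::{real_normed_vector, complete_space} \<Rightarrow>\<^sub>L 'h"
  assumes "closed V" "0 \<in> V" "\<And>T. T \<in> V \<Longrightarrow> (1/2) *\<^sub>R (a + (T o\<^sub>L T)) \<in> V" "norm a < 1"
  obtains T where "T \<in> V" "norm T \<le> norm a" "T = (1/2) *\<^sub>R (a + (T o\<^sub>L T))"
proof -
  \<comment> \<open>On this ball the map contracts with factor \<open>norm a\<close>; intersecting
    with \<open>V\<close> lets the fixed point inherit the closed conditions that \<open>V\<close>
    encodes.\<close>
  let ?W = "V \<inter> cball 0 (norm a)"
  let ?f = "\<lambda>T. (1/2) *\<^sub>R (a + (T o\<^sub>L T))"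
  have "\<exists>!T\<in>?W. ?f T = T"
  proof (rule Banach_fix[where c = "norm a"])
    show "complete ?W" using assms(1) by (intro complete_if_closed_blinfun closed_Int closed_cball)
    show "?W \<noteq> {}" using assms(2) by auto
    show "?f ` ?W \<subseteq> ?W"
    proof
      fix S assume "S \<in> ?f ` ?W"
      then obtain T where T: "T \<in> V" "norm T \<le> norm a" "S = ?f T" by auto
      have "norm (T o\<^sub>L T) \<le> norm T * norm T" by (rule norm_blinfun_compose)
      also have "\<dots> \<le> norm a * 1"
        using T(2) assms(4) by (intro mult_mono) auto
      finally have "norm (a + (T o\<^sub>L T)) \<le> 2 * norm a"
        using norm_triangle_ineq[of a "T o\<^sub>L T"] by simp
      then show "S \<in> ?W" using T assms(3) by auto
    qed
    show "dist (?f S) (?f T) \<le> norm a * dist S T" if "S \<in> ?W" "T \<in> ?W" for S T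
    proof -
      \<comment> \<open>This form of the difference of squares is valid for noncommuting
        \<open>S\<close> and \<open>T\<close>.\<close>
      have "?f S - ?f T = (1/2) *\<^sub>R ((S o\<^sub>L (S - T)) + ((S - T) o\<^sub>L T))"
        by (rule blinfun_eqI) (simp add: blinfun.bilinear_simps algebra_simps)
      moreover have "norm (S o\<^sub>L (S - T)) \<le> norm a * norm (S - T)"
        using that by (intro order_trans[OF norm_blinfun_compose] mult_right_mono) auto
      moreover have "norm ((S - T) o\<^sub>L T) \<le> norm (S - T) * norm a"
        using that by (intro order_trans[OF norm_blinfun_compose] mult_left_mono) auto
      ultimately show ?thesis
        using norm_triangle_ineq[of "S o\<^sub>L (S - T)" "(S - T) o\<^sub>L T"]
        by (simp add: dist_norm mult.commute)
    qed
  qed (use assms in auto)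
  then show ?thesis using that by (metis Int_iff mem_cball_0)
qed

section \<open>Spectral projections of invertible elements of a corner\<close>

locale operator_algebra =
  fixes A :: "('h::{real_inner, complete_space} \<Rightarrow>\<^sub>L 'h) set"
  assumes closed: "closed A"
    and zero: "0 \<in> A"
    and add: "S \<in> A \<Longrightarrow> T \<in> A \<Longrightarrow> S + T \<in> A"
    and scaleR: "T \<in> A \<Longrightarrow> r *\<^sub>R T \<in> A"
    and compose: "S \<in> A \<Longrightarrow> T \<in> A \<Longrightarrow> S o\<^sub>L T \<in> A"
    and adjoint: "T \<in> A \<Longrightarrow>
      \<exists>S\<in>A. \<forall>x y. blinfun_apply T x \<bullet> y = x \<bullet> blinfun_apply S y"
begin

lemma diff: "S \<in> A \<Longrightarrow> T \<in> A \<Longrightarrow> S - T \<in> A"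
  using add[of S "(-1) *\<^sub>R T"] scaleR[of T "-1"] by simp

text \<open>
  Here \<open>m = |z|\<close> is the square root of \<open>z\<^sup>2\<close>, and \<open>m t\<close> is the sign of \<open>z\<close>.
\<close>

lemma positive_spectral_projection_contraction:
  assumes mem: "P \<in> A" "z \<in> A" "t \<in> A"
    and sym: "symmetric_op P" "symmetric_op z" "symmetric_op t"
    and P: "P o\<^sub>L P = P" and Pz: "P o\<^sub>L z = z" and Pt: "P o\<^sub>L t = t"
    and zt: "z o\<^sub>L t = P" and z1: "norm z \<le> 1"
  obtains R where "R \<in> A" "symmetric_op R" "R o\<^sub>L R = R" "R o\<^sub>L P = R"
    "\<And>v. blinfun_apply R v = v \<Longrightarrow> 0 \<le> blinfun_apply z v \<bullet> v"
    "\<And>v. R = 0 \<Longrightarrow> blinfun_apply z v \<bullet> v \<le> 0"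
proof -
  note tz = symmetric_compose_swap[OF sym(2,3,1) zt]
  note zP = symmetric_compose_swap[OF sym(1,2,2) Pz]
  note tP = symmetric_compose_swap[OF sym(1,3,3) Pt]
  note ap = P[THEN blinfun_compose_eqD] Pz[THEN blinfun_compose_eqD] Pt[THEN blinfun_compose_eqD]
    zt[THEN blinfun_compose_eqD] tz[THEN blinfun_compose_eqD] zP[THEN blinfun_compose_eqD]
    tP[THEN blinfun_compose_eqD]
  note sy = sym[THEN symmetric_opD]
  \<comment> \<open>In the corner with unit \<open>P\<close> this is \<open>1 - z\<^sup>2\<close>,
    so \<open>P - T\<close> for the fixed point \<open>T\<close> below squares to
    \<open>z\<^sup>2\<close>. The bound \<open>norm a < 1\<close> comes from the inverse
    \<open>t\<close>.\<close>
  define a where "a = P - (z o\<^sub>L z)"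
  have "norm a < 1"
  proof -
    \<comment> \<open>Since \<open>t\<close> inverts \<open>z\<close> on the corner,
      \<open>norm (P v) \<le> k * norm (z v)\<close>; inserted into the estimate of
      \<open>norm (a v)\<close>, this yields the factor \<open>q\<close>. The added 1 makes
      \<open>k \<ge> 1\<close>, so the radicand of \<open>q\<close> is nonnegative.\<close>
    define k where "k = norm t + 1"
    have k: "k \<ge> 1" by (simp add: k_def)
    define q where "q = sqrt (1 - 1 / k\<^sup>2)"
    have "norm (blinfun_apply a v) \<le> q * norm v" for v
    proof -
      let ?w = "blinfun_apply z v"
      have "(norm (blinfun_apply a v))\<^sup>2 = (norm (blinfun_apply P v))\<^sup>2 - 2 * (norm ?w)\<^sup>2
          + (norm (blinfun_apply z ?w))\<^sup>2"
        by (simp add: a_def blinfun.bilinear_simps power2_norm_eq_inner inner_diff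
            inner_commute sy ap)
      also have "(norm (blinfun_apply z ?w))\<^sup>2 \<le> (norm ?w)\<^sup>2"
      proof (rule power_mono)
        show "norm (blinfun_apply z ?w) \<le> norm ?w"
          using norm_blinfun[of z ?w] mult_right_mono[OF z1, of "norm ?w"] by simp
      qed simp
      finally have 1: "(norm (blinfun_apply a v))\<^sup>2 \<le> (norm (blinfun_apply P v))\<^sup>2 - (norm ?w)\<^sup>2"
        by simp
      have "norm (blinfun_apply P v) \<le> k * norm ?w"
        using norm_blinfun[of t ?w] by (simp add: ap k_def algebra_simps)
          (use norm_ge_zero[of ?w] in linarith)
      then have "(norm (blinfun_apply P v))\<^sup>2 \<le> k\<^sup>2 * (norm ?w)\<^sup>2"
        using power_mono[of "norm (blinfun_apply P v)" "k * norm ?w" 2]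
        by (simp add: power_mult_distrib)
      then have "(norm (blinfun_apply P v))\<^sup>2 / k\<^sup>2 \<le> (norm ?w)\<^sup>2"
        using k by (simp add: divide_simps mult.commute)
      with 1 have "(norm (blinfun_apply a v))\<^sup>2 \<le> (1 - 1 / k\<^sup>2) * (norm (blinfun_apply P v))\<^sup>2"
        by (simp add: algebra_simps)
      also have "\<dots> \<le> (1 - 1 / k\<^sup>2) * (norm v)\<^sup>2"
        using k norm_symmetric_idempotent_le[OF sym(1) P]
        by (intro mult_left_mono power_mono) auto
      finally show ?thesis
        unfolding q_def by (metis norm_ge_zero real_le_rsqrt real_sqrt_mult real_sqrt_abs abs_norm_cancel)
    qed
    moreover have "0 \<le> q" "q < 1" using k by (auto simp: q_def)
    ultimately show ?thesis
      using norm_blinfun_bound[of q a] by fastforce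
  qed
  \<comment> \<open>Symmetry, commutation with \<open>z\<close> and \<open>P T = T\<close> are
    closed conditions preserved by the iteration, so the square root acquires them without a
    functional calculus.\<close>
  define V where "V = {T \<in> A. symmetric_op T \<and>
    (\<forall>v. blinfun_apply z (blinfun_apply T v) = blinfun_apply T (blinfun_apply z v)) \<and>
    (\<forall>v. blinfun_apply P (blinfun_apply T v) = blinfun_apply T v)}"
  have "V = A \<inter> {T. symmetric_op T} \<inter>
    {T. \<forall>v. blinfun_apply z (blinfun_apply T v) = blinfun_apply T (blinfun_apply z v)} \<inter>
    {T. \<forall>v. blinfun_apply P (blinfun_apply T v) = blinfun_apply T v}"
    by (auto simp: V_def)
  also have "closed \<dots>"
    by (intro closed_Int closed closed_symmetric_op closed_Collect_all closed_Collect_eq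
        continuous_intros)
  finally have "closed V" .
  have "a \<in> V"
    using mem diff compose
    by (auto simp: V_def a_def symmetric_op_def blinfun.bilinear_simps inner_diff sy ap)
  obtain T where T: "T \<in> V" "norm T \<le> norm a" "T = (1/2) *\<^sub>R (a + (T o\<^sub>L T))"
  proof (rule sqrt_fixed_point[of V a])
    show "0 \<in> V" by (simp add: V_def zero symmetric_op_def)
    show "(1/2) *\<^sub>R (a + (T o\<^sub>L T)) \<in> V" if "T \<in> V" for T
      using that \<open>a \<in> V\<close> add scaleR compose
      by (auto simp: V_def symmetric_op_def blinfun.bilinear_simps inner_add)
  qed (use \<open>closed V\<close> \<open>norm a < 1\<close> in auto)
  define m where "m = P - T"
  have TA: "T \<in> A" and symT: "symmetric_op T"
    and zT: "\<And>v. blinfun_apply z (blinfun_apply T v) = blinfun_apply T (blinfun_apply z v)"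
    and PT: "\<And>v. blinfun_apply P (blinfun_apply T v) = blinfun_apply T v"
    using T(1) by (auto simp: V_def)
  have "P o\<^sub>L T = T" by (rule blinfun_eqI) (simp add: PT)
  from symmetric_compose_swap[OF sym(1) symT symT this]
  have TP: "\<And>v. blinfun_apply T (blinfun_apply P v) = blinfun_apply T v"
    by (rule blinfun_compose_eqD)
  have symm: "symmetric_op m"
    unfolding m_def symmetric_op_def
    by (simp add: blinfun.bilinear_simps inner_diff sy symmetric_opD[OF symT])
  have zm: "blinfun_apply z (blinfun_apply m v) = blinfun_apply m (blinfun_apply z v)" for v
    by (simp add: m_def blinfun.bilinear_simps zT ap)
  have Pm: "blinfun_apply P (blinfun_apply m v) = blinfun_apply m v"
    and mP: "blinfun_apply m (blinfun_apply P v) = blinfun_apply m v" for v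
    by (simp_all add: m_def blinfun.bilinear_simps PT TP ap)
  \<comment> \<open>On the corner \<open>t\<close> is the inverse of \<open>z\<close>, so
    \<open>t m = t m z t = t z m t = P m t\<close>.\<close>
  have tm: "blinfun_apply t (blinfun_apply m v) = blinfun_apply m (blinfun_apply t v)" for v
  proof -
    have "blinfun_apply t (blinfun_apply m v) = blinfun_apply t (blinfun_apply m (blinfun_apply z (blinfun_apply t v)))"
      by (simp add: ap mP)
    also have "\<dots> = blinfun_apply P (blinfun_apply m (blinfun_apply t v))"
      by (simp only: zm[symmetric] ap(5))
    finally show ?thesis by (simp add: Pm)
  qed
  \<comment> \<open>The fixed-point equation says \<open>2 T = P - z z + T T\<close>, so
    \<open>(P - T) (P - T) = P - 2 T + T T = z z\<close>.\<close>
  have mm: "blinfun_apply m (blinfun_apply m v) = blinfun_apply z (blinfun_apply z v)" for v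
  proof -
    have "blinfun_apply T v = (1/2) *\<^sub>R (blinfun_apply P v - blinfun_apply z (blinfun_apply z v)
        + blinfun_apply T (blinfun_apply T v))"
      using arg_cong[OF T(3), of "\<lambda>S. blinfun_apply S v"]
      by (simp add: a_def blinfun.bilinear_simps)
    then have "2 *\<^sub>R blinfun_apply T v = blinfun_apply P v - blinfun_apply z (blinfun_apply z v)
        + blinfun_apply T (blinfun_apply T v)"
      by (metis (no_types, lifting) scaleR_half_double scaleR_scaleR scaleR_2 scaleR_right_distrib)
    then show ?thesis
      by (simp add: m_def blinfun.bilinear_simps PT TP ap scaleR_2 algebra_simps)
  qed
  have mpos: "0 \<le> blinfun_apply m v \<bullet> v" for v
  proof -
    let ?w = "blinfun_apply P v"
    have "blinfun_apply T ?w \<bullet> ?w \<le> norm (blinfun_apply T ?w) * norm ?w"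
      by (rule norm_cauchy_schwarz)
    also have "\<dots> \<le> (1 * norm ?w) * norm ?w"
      using T(2) \<open>norm a < 1\<close>
      by (intro mult_right_mono order_trans[OF norm_blinfun]) auto
    also have "\<dots> = ?w \<bullet> ?w" by (simp flip: power2_eq_square power2_norm_eq_inner)
    finally have "0 \<le> blinfun_apply m ?w \<bullet> ?w"
      by (simp add: m_def blinfun.bilinear_simps inner_diff ap)
    also have "\<dots> = blinfun_apply m v \<bullet> v"
      by (simp add: mP flip: sy(1)) (simp add: Pm)
    finally show ?thesis .
  qed
  define s where "s = m o\<^sub>L t"
  have s: "blinfun_apply s v = blinfun_apply m (blinfun_apply t v)" for v
    by (simp add: s_def)
  have ss: "blinfun_apply s (blinfun_apply s v) = blinfun_apply P v" for v
    by (simp add: s tm mm ap)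
  have Ps: "blinfun_apply P (blinfun_apply s v) = blinfun_apply s v"
    and sP: "blinfun_apply s (blinfun_apply P v) = blinfun_apply s v" for v
    by (simp_all add: s Pm ap)
  have zs: "blinfun_apply z (blinfun_apply s v) = blinfun_apply m v" for v
    by (simp add: s zm ap mP)
  \<comment> \<open>\<open>s\<close> is a symmetric square root of \<open>P\<close>, and this is the
    projection onto its eigenspace for 1. There \<open>z\<close> agrees with \<open>m\<close>, while
    \<open>R = 0\<close> forces \<open>s = - P\<close> and \<open>z = - m\<close>.\<close>
  define R where "R = (1/2) *\<^sub>R (P + s)"
  show ?thesis
  proof (rule that)
    show "R \<in> A"
      unfolding R_def s_def m_def by (intro scaleR add compose diff mem TA)
    show "symmetric_op R"
      unfolding R_def s_def symmetric_op_def
      by (simp add: blinfun.bilinear_simps inner_add sy symmetric_opD[OF symm] tm)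
    show "R o\<^sub>L R = R"
    proof (rule blinfun_eqI)
      fix v
      have "blinfun_apply R (blinfun_apply R v)
          = (1/4) *\<^sub>R (2 *\<^sub>R (blinfun_apply P v + blinfun_apply s v))"
        unfolding scaleR_2
        by (simp add: R_def blinfun.bilinear_simps ap ss Ps sP scaleR_right_distrib ac_simps)
      then show "blinfun_apply (R o\<^sub>L R) v = blinfun_apply R v"
        by (simp add: R_def blinfun.bilinear_simps)
    qed
    show "R o\<^sub>L P = R"
      by (rule blinfun_eqI) (simp add: R_def blinfun.bilinear_simps ap sP)
    show "0 \<le> blinfun_apply z v \<bullet> v" if "blinfun_apply R v = v" for v
    proof -
      have "blinfun_apply s (blinfun_apply R v) = blinfun_apply R v"
        by (simp add: R_def blinfun.bilinear_simps ss sP add.commute)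
      then have "blinfun_apply z v = blinfun_apply m v"
        using zs[of v] that by simp
      then show ?thesis using mpos[of v] by simp
    qed
    show "blinfun_apply z v \<bullet> v \<le> 0" if "R = 0" for v
    proof -
      have "blinfun_apply R (blinfun_apply s v) = 0" using that by simp
      then have "blinfun_apply P v = - blinfun_apply s v"
        by (simp add: R_def blinfun.bilinear_simps Ps ss eq_neg_iff_add_eq_0 add.commute)
      then have "blinfun_apply z v = - blinfun_apply m v"
        using zs[of v] ap(6)[of v] by (simp add: blinfun.bilinear_simps)
      then show ?thesis using mpos[of v] by simp
    qed
  qed
qed

text \<open>Dividing \<open>z\<close> by \<open>norm z + 1\<close> and multiplying its inverse by
  the same number reduces to norm at most 1; a positive factor leaves the signs of the form
  unchanged.\<close>

lemma positive_spectral_projection: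
  assumes mem: "P \<in> A" "z \<in> A" "t \<in> A"
    and sym: "symmetric_op P" "symmetric_op z" "symmetric_op t"
    and P: "P o\<^sub>L P = P" and Pz: "P o\<^sub>L z = z" and Pt: "P o\<^sub>L t = t"
    and zt: "z o\<^sub>L t = P"
  obtains R where "R \<in> A" "symmetric_op R" "R o\<^sub>L R = R" "R o\<^sub>L P = R"
    "\<And>v. blinfun_apply R v = v \<Longrightarrow> 0 \<le> blinfun_apply z v \<bullet> v"
    "\<And>v. R = 0 \<Longrightarrow> blinfun_apply z v \<bullet> v \<le> 0"
proof -
  define c where "c = norm z + 1"
  have c: "c > 0" "norm z \<le> c" by (simp_all add: c_def add_nonneg_pos)
  note Pz' = Pz[THEN blinfun_compose_eqD] and Pt' = Pt[THEN blinfun_compose_eqD]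
    and zt' = zt[THEN blinfun_compose_eqD]
  show ?thesis
  proof (rule positive_spectral_projection_contraction[of P "(1/c) *\<^sub>R z" "c *\<^sub>R t"])
    show "symmetric_op ((1/c) *\<^sub>R z)" "symmetric_op (c *\<^sub>R t)"
      using sym by (simp_all add: symmetric_op_def blinfun.bilinear_simps)
    show "P o\<^sub>L ((1/c) *\<^sub>R z) = (1/c) *\<^sub>R z" "P o\<^sub>L (c *\<^sub>R t) = c *\<^sub>R t"
      by (rule blinfun_eqI, simp add: blinfun.bilinear_simps Pz' Pt')+
    show "((1/c) *\<^sub>R z) o\<^sub>L (c *\<^sub>R t) = P"
      using c by (intro blinfun_eqI) (simp add: blinfun.bilinear_simps zt')
    show "norm ((1/c) *\<^sub>R z) \<le> 1" using c by simp
  qed (use mem sym P c that in \<open>auto simp: scaleR blinfun.bilinear_simps zero_le_divide_iff divide_le_0_iff\<close>)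
qed

section \<open>Schur complements in a corner\<close>

text \<open>
  Writing \<open>F = E - P\<close>, the operator \<open>z\<close> is the Schur complement
  \<open>PyP - PyF (FyF)\<^sup>-\<^sup>1 FyP\<close>, whose inverse in the corner is \<open>PYP\<close>, and
  \<open>g = PyF (FyF)\<^sup>-\<^sup>1\<close>.
\<close>

lemma schur_complement:
  assumes PA: "P \<in> A" and cA: "c \<in> A"
    and sym: "symmetric_op P" "symmetric_op c" "symmetric_op E" "symmetric_op y"
    and P: "P o\<^sub>L P = P" and E: "E o\<^sub>L E = E" and PE: "P o\<^sub>L E = P" and Pc: "P o\<^sub>L c = c"
    and yE: "y o\<^sub>L E = y" and EY: "E o\<^sub>L Y = Y" and yY: "y o\<^sub>L Y = E"
    and ideal: "\<And>T. T \<in> A \<Longrightarrow> T o\<^sub>L E \<in> A" "\<And>T. T \<in> A \<Longrightarrow> T o\<^sub>L y \<in> A"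
      "\<And>T. T \<in> A \<Longrightarrow> T o\<^sub>L Y \<in> A"
    and near: "norm (y - (c + (E - P))) \<le> \<delta>" and \<delta>: "\<delta> \<le> 1/2"
  obtains z t where "z \<in> A" "t \<in> A" "symmetric_op z" "symmetric_op t"
    "P o\<^sub>L z = z" "P o\<^sub>L t = t" "z o\<^sub>L t = P"
    "\<And>v. \<bar>blinfun_apply z v \<bullet> v - blinfun_apply c v \<bullet> v\<bar> \<le> 2 * \<delta> * (norm v)\<^sup>2"
proof -
  note EP = symmetric_compose_swap[OF sym(1,3,1) PE]
  note cP = symmetric_compose_swap[OF sym(1,2,2) Pc]
  note ap = P[THEN blinfun_compose_eqD] E[THEN blinfun_compose_eqD] PE[THEN blinfun_compose_eqD]
    EP[THEN blinfun_compose_eqD] Pc[THEN blinfun_compose_eqD] cP[THEN blinfun_compose_eqD]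
    yE[THEN blinfun_compose_eqD] EY[THEN blinfun_compose_eqD]
    yY[THEN blinfun_compose_eqD]
  note sy = sym[THEN symmetric_opD]
  define F where "F = E - P"
  define D where "D = y - (c + F)"
  have \<delta>0: "0 \<le> \<delta>" and D: "norm D \<le> \<delta>"
    using order_trans[OF norm_ge_zero near] near by (simp_all add: D_def F_def)
  have Ec: "blinfun_apply E (blinfun_apply c v) = blinfun_apply c v" for v
    by (metis ap(4,5))
  have cE: "blinfun_apply c (blinfun_apply E v) = blinfun_apply c v" for v
    by (metis ap(3,6))
  have F: "blinfun_apply F (blinfun_apply F v) = blinfun_apply F v"
    "blinfun_apply F (blinfun_apply P v) = 0" "blinfun_apply P (blinfun_apply F v) = 0"
    "blinfun_apply F (blinfun_apply c v) = 0" "blinfun_apply c (blinfun_apply F v) = 0"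
    "blinfun_apply F (blinfun_apply E v) = blinfun_apply F v" for v
    by (simp_all add: F_def blinfun.bilinear_simps ap Ec cE)
  have E_split: "blinfun_apply E v = blinfun_apply P v + blinfun_apply F v" for v
    by (simp add: F_def blinfun.bilinear_simps)
  have y_split: "blinfun_apply y v = blinfun_apply c v + blinfun_apply F v + blinfun_apply D v" for v
    by (simp add: D_def blinfun.bilinear_simps)
  have symF: "symmetric_op F"
    by (simp add: F_def symmetric_op_def blinfun.bilinear_simps inner_diff sy)
  have "F o\<^sub>L F = F" by (rule blinfun_eqI) (simp add: F)
  note normF = norm_symmetric_idempotent_le[OF symF this]
  note normP = norm_symmetric_idempotent_le[OF sym(1) P]
  have normD: "norm (blinfun_apply D v) \<le> \<delta> * norm v" for v
    by (rule order_trans[OF norm_blinfun]) (intro mult_right_mono D norm_ge_zero)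
  \<comment> \<open>\<open>E\<close>, \<open>y\<close> and \<open>Y\<close>, hence also
    \<open>F\<close> and \<open>D\<close>, may lie outside \<open>A\<close>; products with them stay
    in \<open>A\<close> once the leftmost factor is in \<open>A\<close>.\<close>
  have right_F: "T o\<^sub>L F \<in> A" if "T \<in> A" for T
  proof -
    have "T o\<^sub>L F = (T o\<^sub>L E) - (T o\<^sub>L P)"
      by (rule blinfun_eqI) (simp add: F_def blinfun.bilinear_simps)
    then show ?thesis using that PA ideal(1) compose diff by simp
  qed
  have right_D: "T o\<^sub>L D \<in> A" if "T \<in> A" for T
  proof -
    have "T o\<^sub>L D = (T o\<^sub>L y) - (T o\<^sub>L c) - (T o\<^sub>L F)"
      by (rule blinfun_eqI) (simp add: D_def blinfun.bilinear_simps algebra_simps)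
    then show ?thesis using that cA ideal(2) compose diff right_F by simp
  qed
  \<comment> \<open>\<open>F y F = F + F D F\<close> acts on the range of \<open>F\<close> as
    \<open>1 - d\<close>, which a Neumann series inverts.\<close>
  define d where "d = - (F o\<^sub>L D o\<^sub>L F)"
  have d: "blinfun_apply d v = - blinfun_apply F (blinfun_apply D (blinfun_apply F v))" for v
    by (simp add: d_def blinfun.bilinear_simps)
  have norm_d: "norm d \<le> \<delta>"
  proof (rule norm_blinfun_bound[OF \<delta>0])
    show "norm (blinfun_apply d v) \<le> \<delta> * norm v" for v
      using normF[of "blinfun_apply D (blinfun_apply F v)"] normD[of "blinfun_apply F v"]
        mult_left_mono[OF normF[of v] \<delta>0] by (simp add: d)
  qed
  \<comment> \<open>This is \<open>P y F\<close>, because \<open>c\<close> and \<open>F\<close> are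
    block diagonal.\<close>
  define y12 where "y12 = P o\<^sub>L D o\<^sub>L F"
  have y12: "blinfun_apply y12 v = blinfun_apply P (blinfun_apply D (blinfun_apply F v))" for v
    by (simp add: y12_def)
  have norm_y12: "norm y12 \<le> \<delta>"
  proof (rule norm_blinfun_bound[OF \<delta>0])
    show "norm (blinfun_apply y12 v) \<le> \<delta> * norm v" for v
      using normP[of "blinfun_apply D (blinfun_apply F v)"] normD[of "blinfun_apply F v"]
        mult_left_mono[OF normF[of v] \<delta>0] by (simp add: y12)
  qed
  obtain g where gA: "g \<in> A" and g: "g = y12 + (g o\<^sub>L d)"
  proof (rule neumann_fixed_point[of A y12 d])
    show y12A: "y12 \<in> A" unfolding y12_def by (intro right_F right_D PA)
    show "y12 + (g o\<^sub>L d) \<in> A" if "g \<in> A" for g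
    proof -
      have "y12 + (g o\<^sub>L d) = y12 - (g o\<^sub>L F o\<^sub>L D o\<^sub>L F)"
        by (rule blinfun_eqI) (simp add: d blinfun.bilinear_simps)
      then show ?thesis using that y12A diff right_F right_D by simp
    qed
    show "norm d < 1" using norm_d \<delta> by simp
  qed (rule closed)
  have ga: "blinfun_apply g v = blinfun_apply P (blinfun_apply D (blinfun_apply F v))
      - blinfun_apply g (blinfun_apply F (blinfun_apply D (blinfun_apply F v)))" for v
    using arg_cong[OF g, of "\<lambda>S. blinfun_apply S v"] by (simp add: y12 d blinfun.bilinear_simps)
  have gP: "blinfun_apply g (blinfun_apply P v) = 0" for v
    by (subst ga) (simp add: F)
  have gF: "blinfun_apply g (blinfun_apply F v) = blinfun_apply g v" for v
    by (subst (1 2) ga) (simp add: F)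
  have Pg: "blinfun_apply P (blinfun_apply g v) = blinfun_apply g v" for v
  proof -
    \<comment> \<open>The defect of \<open>P g = g\<close> solves the homogeneous equation
      \<open>e = e d\<close>, and \<open>norm d \<le> 1/2\<close> forces it to vanish.\<close>
    define e where "e = g - (P o\<^sub>L g)"
    have e: "blinfun_apply e v = blinfun_apply g v - blinfun_apply P (blinfun_apply g v)" for v
      by (simp add: e_def blinfun.bilinear_simps)
    have "e = e o\<^sub>L d"
    proof (rule blinfun_eqI)
      fix v
      have gv: "blinfun_apply g v = blinfun_apply y12 v + blinfun_apply g (blinfun_apply d v)"
        using arg_cong[OF g, of "\<lambda>S. blinfun_apply S v"] by (simp add: blinfun.bilinear_simps)
      have "blinfun_apply P (blinfun_apply y12 v) = blinfun_apply y12 v" by (simp add: y12 ap)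
      then show "blinfun_apply e v = blinfun_apply (e o\<^sub>L d) v"
        by (simp add: e gv blinfun.bilinear_simps)
    qed
    then have "norm e \<le> norm e * norm d"
      by (metis norm_blinfun_compose)
    also have "\<dots> \<le> norm e * (1/2)"
      using norm_d \<delta> by (intro mult_left_mono) auto
    finally have "e = 0" by simp
    then show ?thesis using e[of v] by simp
  qed
  have norm_g: "norm g \<le> 1"
  proof -
    have "norm g \<le> norm y12 + norm g * norm d"
      using norm_triangle_ineq[of y12 "g o\<^sub>L d"] norm_blinfun_compose[of g d] g by simp
    also have "\<dots> \<le> 1/2 + norm g * (1/2)"
      using norm_y12 norm_d \<delta> by (intro add_mono mult_left_mono) auto
    finally show ?thesis by simp
  qed
  have off_diagonal: "blinfun_apply P (blinfun_apply y (blinfun_apply F v))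
      = blinfun_apply g (blinfun_apply y (blinfun_apply F v))" for v
  proof -
    have "blinfun_apply g (blinfun_apply y (blinfun_apply F v))
        = blinfun_apply g v + blinfun_apply g (blinfun_apply F (blinfun_apply D (blinfun_apply F v)))"
      by (simp add: y_split blinfun.bilinear_simps F gF)
    also have "\<dots> = blinfun_apply P (blinfun_apply D (blinfun_apply F v))"
      by (subst ga) simp
    finally show ?thesis by (simp add: y_split blinfun.bilinear_simps F)
  qed
  define z where "z = (P - g) o\<^sub>L y o\<^sub>L P"
  define t where "t = P o\<^sub>L Y o\<^sub>L P"
  have z: "blinfun_apply z v = blinfun_apply P (blinfun_apply y v) - blinfun_apply g (blinfun_apply y v)" for v
  proof -
    have "blinfun_apply y v = blinfun_apply y (blinfun_apply P v) + blinfun_apply y (blinfun_apply F v)"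
      using E_split[of v] ap(7)[of v] by (metis blinfun.add_right)
    then show ?thesis by (simp add: z_def blinfun.bilinear_simps off_diagonal)
  qed
  have zP: "blinfun_apply z (blinfun_apply P v) = blinfun_apply z v" for v
    by (simp add: z_def ap)
  have gE: "blinfun_apply g (blinfun_apply E v) = blinfun_apply g v" for v
    by (simp add: E_split blinfun.bilinear_simps gP gF)
  have symY: "blinfun_apply Y u \<bullet> v = u \<bullet> blinfun_apply Y v" for u v
  proof -
    have "blinfun_apply Y u \<bullet> v = blinfun_apply E (blinfun_apply Y u) \<bullet> v" by (simp add: ap)
    also have "\<dots> = blinfun_apply Y u \<bullet> blinfun_apply y (blinfun_apply Y v)"
      by (simp only: sy(3) ap(9))
    also have "\<dots> = blinfun_apply E u \<bullet> blinfun_apply Y v"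
      by (subst sy(4)[symmetric]) (simp only: ap(9))
    finally show ?thesis by (simp add: sy ap)
  qed
  show ?thesis
  proof (rule that)
    show "z \<in> A" unfolding z_def by (intro compose ideal diff PA gA)
    show "t \<in> A" unfolding t_def by (intro compose ideal PA)
    show "symmetric_op z"
    proof -
      obtain h where h: "\<And>u v. blinfun_apply g u \<bullet> v = u \<bullet> blinfun_apply h v"
        using adjoint[OF gA] by blast
      have Ph: "blinfun_apply P (blinfun_apply h v) = 0" for v
      proof -
        have "u \<bullet> blinfun_apply P (blinfun_apply h v) = 0" for u
          by (simp add: gP flip: sy(1) h)
        then show ?thesis by (metis inner_eq_zero_iff)
      qed
      \<comment> \<open>The adjoint \<open>h\<close> of \<open>g\<close> maps into the kernel of
        \<open>P\<close>, so \<open>z\<close> is the congruence \<open>(P - g) y (P - h)\<close>,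
        which inherits symmetry from \<open>y\<close>.\<close>
      have "blinfun_apply z u \<bullet> v = blinfun_apply y (blinfun_apply P u - blinfun_apply h u)
          \<bullet> (blinfun_apply P v - blinfun_apply h v)" for u v
      proof -
        have "blinfun_apply z u = blinfun_apply z (blinfun_apply P u - blinfun_apply h u)"
          by (subst (1 2) zP[symmetric]) (simp add: blinfun.bilinear_simps Ph ap)
        then show ?thesis
          by (simp add: z inner_diff h sy)
      qed
      then show ?thesis unfolding symmetric_op_def by (metis sy(4) inner_commute)
    qed
    show "symmetric_op t" by (simp add: symmetric_op_def t_def sy symY)
    show "P o\<^sub>L z = z" by (rule blinfun_eqI) (simp add: z blinfun.bilinear_simps ap Pg)
    show "P o\<^sub>L t = t" by (rule blinfun_eqI) (simp add: t_def ap)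
    \<comment> \<open>The inner \<open>P\<close> disappears:
      \<open>z t = z Y P = (P - g) y Y P = (P - g) E P = P\<close>.\<close>
    show "z o\<^sub>L t = P"
      by (rule blinfun_eqI) (simp add: t_def zP, simp add: z ap gE gP)
    show "\<bar>blinfun_apply z v \<bullet> v - blinfun_apply c v \<bullet> v\<bar> \<le> 2 * \<delta> * (norm v)\<^sup>2" for v
    proof -
      let ?w = "blinfun_apply D (blinfun_apply P v)"
      \<comment> \<open>The difference is \<open>(P - g) D P\<close>; \<open>P\<close> and
        \<open>g\<close> are contractions, whence the factor 2.\<close>
      have "blinfun_apply z v - blinfun_apply c v = blinfun_apply P ?w - blinfun_apply g ?w"
      proof -
        have "blinfun_apply g (blinfun_apply c u) = 0" for u by (metis gF F(4) blinfun.zero_right)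
        then show ?thesis
          by (subst zP[symmetric]) (simp add: z y_split blinfun.bilinear_simps F ap)
      qed
      moreover have "norm (blinfun_apply P ?w - blinfun_apply g ?w) \<le> 2 * \<delta> * norm v"
      proof -
        have "norm ?w \<le> \<delta> * norm v"
          using normD[of "blinfun_apply P v"] mult_left_mono[OF normP[of v] \<delta>0] by simp
        moreover have "norm (blinfun_apply g ?w) \<le> norm ?w"
          using norm_blinfun[of g ?w] mult_right_mono[OF norm_g, of "norm ?w"] by simp
        ultimately show ?thesis
          using norm_triangle_ineq4[of "blinfun_apply P ?w" "blinfun_apply g ?w"] normP[of ?w] by simp
      qed
      ultimately have "\<bar>(blinfun_apply z v - blinfun_apply c v) \<bullet> v\<bar> \<le> (2 * \<delta> * norm v) * norm v"
        by (metis Cauchy_Schwarz_ineq2 mult_right_mono norm_ge_zero order_trans)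
      then show ?thesis by (simp add: inner_diff power2_eq_square mult.assoc)
    qed
  qed
qed

end

section \<open>Reduction to real inner products and use of real rank zero\<close>

context hilbert_space
begin

lemma re_part_diff: "re_part (a - b :: 'f) = re_part a - re_part b"
proof -
  have "re_part (a + b) = re_part a + re_part b" for a b :: 'f
  proof -
    have "of_real (2 * re_part (a + b)) = (a + conjugate a) + (b + conjugate b)"
      by (simp only: conjugate_add ac_simps flip: add_conjugate)
    also have "\<dots> = (of_real (2 * re_part a + 2 * re_part b) :: 'f)"
      by (simp only: add_conjugate of_real_add)
    finally show ?thesis by (simp only: of_real_eq_iff)
  qed
  from this[of "a - b" b] show ?thesis by simp
qed

text \<open>For \<open>c = conjugate (a - b)\<close> the real part of \<open>c * (a - b)\<close> is
  the squared norm of the difference.\<close>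

lemma eq_if_re_part_mult_eq:
  assumes "\<And>c. re_part (c * a :: 'f) = re_part (c * b)"
  shows "a = b"
proof -
  have "conjugate (a - b) * (a - b) = of_real ((norm (a - b))\<^sup>2)"
    by (metis mult_conjugate mult.commute)
  moreover have "re_part (conjugate (a - b) * (a - b)) = 0"
    using assms[of "conjugate (a - b)"] re_part_diff by (simp add: right_diff_distrib)
  moreover have "re_part (of_real r :: 'f) = r" for r
  proof -
    have "conjugate (of_real r :: 'f) = of_real r"
    proof (cases "r = 0")
      case True
      then show ?thesis using conjugate_add[of "0::'f" 0] by simp
    next
      case False
      have "of_real r * conjugate (of_real r :: 'f) = of_real r * of_real r"
        by (simp add: mult_conjugate power2_eq_square)
      then show ?thesis using False by simp
    qed
    then have "of_real (2 * r) = (of_real (2 * re_part (of_real r :: 'f)) :: 'f)"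
      using add_conjugate[of "of_real r :: 'f"] by (simp only: mult_2 of_real_add)
    then show ?thesis by (simp only: of_real_eq_iff)
  qed
  ultimately have "(norm (a - b))\<^sup>2 = 0" by metis
  then show ?thesis by simp
qed

text \<open>One direction takes real parts. For the other, \<open>'f\<close>-linearity of
  \<open>T\<close> moves a scalar \<open>c\<close> into \<open>x\<close>, so the real identity
  determines the real part of every multiple of both sides.\<close>

lemma is_adjoint_iff:
  assumes "T \<in> operators smul"
  shows "is_adjoint ip T S \<longleftrightarrow> (\<forall>x y. blinfun_apply T x \<bullet> y = x \<bullet> blinfun_apply S y)"
proof
  show "is_adjoint ip T S \<Longrightarrow> \<forall>x y. blinfun_apply T x \<bullet> y = x \<bullet> blinfun_apply S y"
    by (metis is_adjoint_def re_ip)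
  assume *: "\<forall>x y. blinfun_apply T x \<bullet> y = x \<bullet> blinfun_apply S y"
  show "is_adjoint ip T S"
    unfolding is_adjoint_def
  proof (intro allI eq_if_re_part_mult_eq)
    fix x y c
    show "re_part (c * ip (blinfun_apply T x) y) = re_part (c * ip x (blinfun_apply S y))"
      using * assms by (simp add: operators_def re_ip flip: ip_smul_left) metis
  qed
qed

lemma op_scale_of_real: "op_scale smul (of_real r) T = r *\<^sub>R T"
  by (rule blinfun_eqI) (simp add: smul_of_real blinfun.bilinear_simps)

lemma operator_algebra_if_cstar_algebra:
  assumes "cstar_algebra smul ip A"
  shows "operator_algebra A"
proof
  show "r *\<^sub>R T \<in> A" if "T \<in> A" for r T
    using assms that by (metis cstar_algebra_def op_scale_of_real)
  show "\<exists>S\<in>A. \<forall>x y. blinfun_apply T x \<bullet> y = x \<bullet> blinfun_apply S y" if "T \<in> A" for T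
    using assms that is_adjoint_iff by (metis cstar_algebra_def subsetD)
qed (use assms in \<open>auto simp: cstar_algebra_def\<close>)

lemma in_projections_iff:
  assumes "cstar_algebra smul ip A"
  shows "P \<in> projections ip A \<longleftrightarrow> P \<in> A \<and> symmetric_op P \<and> P o\<^sub>L P = P"
  using assms
  by (auto simp: projections_def selfadjoint_elements_def cstar_algebra_def symmetric_op_def
      is_adjoint_iff subsetD)

text \<open>If \<open>S\<close> is the adjoint of \<open>E\<close>, then \<open>E S = S\<close>
  gives \<open>S x \<bullet> y = S x \<bullet> S y\<close>, which is symmetric in \<open>x\<close>
  and \<open>y\<close>; so \<open>S\<close> is symmetric and equals \<open>E\<close>.\<close>

lemma unit_symmetric:
  assumes "cstar_algebra smul ip A" "is_unit_of A E"
  shows "symmetric_op E"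
proof -
  obtain S where S: "S \<in> A" "\<And>x y. blinfun_apply E x \<bullet> y = x \<bullet> blinfun_apply S y"
    using operator_algebra.adjoint[OF operator_algebra_if_cstar_algebra[OF assms(1)], of E] assms(2)
    by (auto simp: is_unit_of_def)
  have "blinfun_apply E (blinfun_apply S x) = blinfun_apply S x" for x
    using assms(2) S(1) by (metis blinfun_apply_blinfun_compose is_unit_of_def)
  then have "blinfun_apply S x \<bullet> y = blinfun_apply S x \<bullet> blinfun_apply S y" for x y
    using S(2)[of "blinfun_apply S x" y] by simp
  then have "blinfun_apply S x \<bullet> y = x \<bullet> blinfun_apply S y" for x y
    by (metis inner_commute)
  then have "blinfun_apply E x \<bullet> y = x \<bullet> blinfun_apply E y" for x y
    using S(2) by (metis inner_commute)
  then show ?thesis by (simp add: symmetric_op_def)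
qed

text \<open>Treats unital and nonunital \<open>A\<close> together: \<open>E\<close> is the unit of
  \<open>A\<close> or the identity operator. The approximant \<open>y\<close> and its inverse
  \<open>Y\<close> lie in the unitization, and right multiplication by them maps \<open>A\<close>
  into itself.\<close>

lemma real_rank_zero_approx:
  assumes A: "cstar_algebra smul ip A" and "real_rank_zero smul ip A"
  obtains E where "symmetric_op E" "E o\<^sub>L E = E" "\<And>T. T \<in> A \<Longrightarrow> T o\<^sub>L E = T"
    "\<And>c \<delta>. c \<in> A \<Longrightarrow> symmetric_op c \<Longrightarrow> \<delta> > 0 \<Longrightarrow>
      \<exists>y Y. symmetric_op y \<and> y o\<^sub>L E = y \<and> E o\<^sub>L Y = Y \<and> y o\<^sub>L Y = E \<and>
        (\<forall>T\<in>A. T o\<^sub>L y \<in> A \<and> T o\<^sub>L Y \<in> A) \<and> norm (y - (c + E)) \<le> \<delta>"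
proof -
  interpret operator_algebra A by (rule operator_algebra_if_cstar_algebra[OF A])
  define B where "B = unitization smul A"
  obtain E where E: "is_unit_of B E" "symmetric_op E" "\<And>T. T \<in> A \<Longrightarrow> T o\<^sub>L E = T"
    and BE: "\<And>T. T \<in> A \<Longrightarrow> T + E \<in> B"
    and ideal: "\<And>S T. S \<in> B \<Longrightarrow> T \<in> A \<Longrightarrow> T o\<^sub>L S \<in> A"
    and B_op: "B \<subseteq> operators smul"
  proof (cases "\<exists>E. is_unit_of A E")
    case True
    then obtain E where "is_unit_of A E" by blast
    moreover have "B = A" using True by (simp add: B_def unitization_def)
    ultimately show ?thesis
      using that[of E] unit_symmetric[OF A] A add compose
      by (auto simp: is_unit_of_def cstar_algebra_def)
  next
    case False
    then have B: "B = {T + op_scale smul c id_blinfun | T c. T \<in> A}"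
      by (simp add: B_def unitization_def)
    have lin: "blinfun_apply T (smul c v) = smul c (blinfun_apply T v)" if "T \<in> A" for T c v
      using that A by (auto simp: cstar_algebra_def operators_def)
    have id1: "op_scale smul 1 id_blinfun = (id_blinfun :: 'h \<Rightarrow>\<^sub>L 'h)"
      by (rule blinfun_eqI) simp
    have BE: "T + id_blinfun \<in> B" if "T \<in> A" for T
      using that id1 by (auto simp: B intro!: exI[of _ T] exI[of _ 1])
    show ?thesis
    proof (rule that)
      show "is_unit_of B id_blinfun"
        using BE[OF zero] by (auto simp: is_unit_of_def intro!: blinfun_eqI)
      show "T o\<^sub>L S \<in> A" if "S \<in> B" "T \<in> A" for S T
      proof -
        obtain U c where U: "U \<in> A" "S = U + op_scale smul c id_blinfun"
          using \<open>S \<in> B\<close> unfolding B by blast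
        have "T o\<^sub>L S = (T o\<^sub>L U) + op_scale smul c T"
          by (rule blinfun_eqI) (simp add: U blinfun.bilinear_simps lin that(2))
        then show ?thesis
          using A U(1) that(2) by (simp add: cstar_algebra_def)
      qed
      show "B \<subseteq> operators smul"
        by (auto simp: B operators_def blinfun.bilinear_simps lin scale_right_distrib
            scale_left_commute)
    qed (use BE in \<open>auto simp: symmetric_op_def intro!: blinfun_eqI\<close>)
  qed
  have approx: "selfadjoint_elements ip B \<subseteq>
      closure (invertible_elements B \<inter> selfadjoint_elements ip B)"
    using assms(2) by (simp add: real_rank_zero_def B_def Let_def)
  have sa: "T \<in> selfadjoint_elements ip B \<longleftrightarrow> T \<in> B \<and> symmetric_op T" for T
    using B_op by (auto simp: selfadjoint_elements_def symmetric_op_def is_adjoint_iff subsetD)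
  show ?thesis
  proof (rule that[OF E(2) _ E(3)])
    show "E o\<^sub>L E = E" using E(1) by (simp add: is_unit_of_def)
    fix c and \<delta> :: real
    assume c: "c \<in> A" "symmetric_op c" and "\<delta> > 0"
    have "symmetric_op (c + E)"
      using c(2) E(2) by (simp add: symmetric_op_def blinfun.bilinear_simps inner_add)
    then have "c + E \<in> closure (invertible_elements B \<inter> selfadjoint_elements ip B)"
      using BE[OF c(1)] approx sa by blast
    then obtain y where y: "y \<in> invertible_elements B" "y \<in> selfadjoint_elements ip B"
      "dist y (c + E) < \<delta>"
      using \<open>\<delta> > 0\<close> by (auto simp: closure_approachable)
    then obtain E' Y where "is_unit_of B E'" and Y: "Y \<in> B" "Y o\<^sub>L y = E'" "y o\<^sub>L Y = E'"
      by (auto simp: invertible_elements_def)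
    moreover have "E' = E"
      using \<open>is_unit_of B E'\<close> E(1) by (metis is_unit_of_def)
    ultimately show "\<exists>y Y. symmetric_op y \<and> y o\<^sub>L E = y \<and> E o\<^sub>L Y = Y \<and> y o\<^sub>L Y = E \<and>
        (\<forall>T\<in>A. T o\<^sub>L y \<in> A \<and> T o\<^sub>L Y \<in> A) \<and> norm (y - (c + E)) \<le> \<delta>"
      using y sa E(1) ideal
      by (intro exI[of _ y] exI[of _ Y]) (auto simp: is_unit_of_def dist_norm)
  qed
qed

end

section \<open>Separativity of the projections\<close>

theorem theorem4p4:
  fixes smul :: "'f::real_or_complex \<Rightarrow> 'h::{real_inner, complete_space} \<Rightarrow> 'h"
    and ip :: "'h \<Rightarrow> 'h \<Rightarrow> 'f"
    and A :: "('h \<Rightarrow>\<^sub>L 'h) set"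
  assumes "hilbert_space smul ip"
    and "cstar_algebra smul ip A"
    and "real_rank_zero smul ip A"
  shows "separative_projections ip A"
proof -
  interpret hilbert_space smul ip by fact
  interpret operator_algebra A by (rule operator_algebra_if_cstar_algebra) fact
  note proj = in_projections_iff[OF assms(2)]
  show ?thesis
    unfolding separative_projections_def
  proof (intro ballI impI)
    fix P Q assume "P \<in> projections ip A" "Q \<in> projections ip A" and PQ: "\<not> proj_le P Q"
    then have P: "P \<in> A" "symmetric_op P" "P o\<^sub>L P = P"
      and Q: "Q \<in> A" "symmetric_op Q" "Q o\<^sub>L Q = Q"
      by (simp_all add: proj)
    note ap = P(3)[THEN blinfun_compose_eqD] Q(3)[THEN blinfun_compose_eqD]
    note sy = P(2)[THEN symmetric_opD] Q(2)[THEN symmetric_opD]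
    \<comment> \<open>Taking adjoints turns \<open>P Q \<noteq> P\<close> into
      \<open>Q P \<noteq> P\<close>, which yields a vector in the range of \<open>P\<close> that
      \<open>Q\<close> moves.\<close>
    have "Q o\<^sub>L P \<noteq> P"
      using PQ symmetric_compose_swap[OF Q(2) P(2) P(2)] by (auto simp: proj_le_def)
    then obtain w where w: "blinfun_apply Q (blinfun_apply P w) \<noteq> blinfun_apply P w"
      by (metis blinfun_apply_blinfun_compose blinfun_eqI)
    define v0 where "v0 = blinfun_apply P w"
    have v0: "blinfun_apply P v0 = v0" "blinfun_apply Q v0 \<noteq> v0" "v0 \<noteq> 0"
      using w by (auto simp: v0_def ap)
    define b where "b = P - (P o\<^sub>L Q o\<^sub>L P)"
    have b: "blinfun_apply b v = blinfun_apply P v - blinfun_apply P (blinfun_apply Q (blinfun_apply P v))" for v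
      by (simp add: b_def blinfun.bilinear_simps)
    have bv0: "blinfun_apply b v0 \<bullet> v0 = (norm (v0 - blinfun_apply Q v0))\<^sup>2"
      using sy(1)[of v0 "blinfun_apply Q v0"]
      by (simp add: b v0 inner_diff sy power2_norm_eq_inner inner_commute ap)
    \<comment> \<open>The quotient is the form of \<open>b\<close> at the normalized
      \<open>v0\<close>; the cap at 1 ensures \<open>\<beta>/8 \<le> 1/2\<close>, as
      \<open>schur_complement\<close> requires.\<close>
    define \<beta> where "\<beta> = min 1 ((norm (v0 - blinfun_apply Q v0))\<^sup>2 / (norm v0)\<^sup>2)"
    have \<beta>: "0 < \<beta>" "\<beta> \<le> 1" using v0 by (auto simp: \<beta>_def)
    have "\<beta> * (norm v0)\<^sup>2 \<le> (norm (v0 - blinfun_apply Q v0))\<^sup>2"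
      using v0(3) by (auto simp: \<beta>_def min_def field_simps)
    then have bv0': "\<beta> * (norm v0)\<^sup>2 \<le> blinfun_apply b v0 \<bullet> v0" by (simp add: bv0)
    \<comment> \<open>Relative to the squared norm, the form of \<open>c\<close> is at least
      \<open>\<beta>/2\<close> at \<open>v0\<close> and equals \<open>-\<beta>/2\<close> on nonzero
      common vectors of \<open>P\<close> and \<open>Q\<close>. The later error
      \<open>2 * (\<beta>/8) = \<beta>/4\<close> preserves both signs.\<close>
    define c where "c = b - (\<beta>/2) *\<^sub>R P"
    have c: "blinfun_apply c v = blinfun_apply b v - (\<beta>/2) *\<^sub>R blinfun_apply P v" for v
      by (simp add: c_def blinfun.bilinear_simps)
    have bA: "b \<in> A" unfolding b_def by (intro diff compose P Q)
    \<comment> \<open>\<open>c - P\<close> is the element to which the approximation is applied,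
      because \<open>(c - P) + E = c + (E - P)\<close>.\<close>
    have cA: "c \<in> A" "c - P \<in> A" unfolding c_def by (intro diff scaleR bA P)+
    have symc: "symmetric_op c"
      by (simp add: symmetric_op_def c b inner_diff sy)
    have symcP: "symmetric_op (c - P)"
      using symc by (simp add: symmetric_op_def blinfun.bilinear_simps inner_diff sy)
    obtain E where E: "symmetric_op E" "E o\<^sub>L E = E" "\<And>T. T \<in> A \<Longrightarrow> T o\<^sub>L E = T"
      and app: "\<And>c \<delta>. c \<in> A \<Longrightarrow> symmetric_op c \<Longrightarrow> \<delta> > 0 \<Longrightarrow>
        \<exists>y Y. symmetric_op y \<and> y o\<^sub>L E = y \<and> E o\<^sub>L Y = Y \<and> y o\<^sub>L Y = E \<and>
          (\<forall>T\<in>A. T o\<^sub>L y \<in> A \<and> T o\<^sub>L Y \<in> A) \<and> norm (y - (c + E)) \<le> \<delta>"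
      using real_rank_zero_approx[OF assms(2,3)] by metis
    obtain y Y where y: "symmetric_op y" "y o\<^sub>L E = y" "E o\<^sub>L Y = Y" "y o\<^sub>L Y = E"
      "\<forall>T\<in>A. T o\<^sub>L y \<in> A \<and> T o\<^sub>L Y \<in> A" "norm (y - (c - P + E)) \<le> \<beta>/8"
      using app[OF cA(2) symcP, of "\<beta>/8"] \<beta> by auto
    have "c - P + E = c + (E - P)" by simp
    with y(6) have near: "norm (y - (c + (E - P))) \<le> \<beta>/8" by metis
    have Pc: "P o\<^sub>L c = c"
      by (rule blinfun_eqI) (simp add: c b blinfun.bilinear_simps ap)
    obtain z t where zt: "z \<in> A" "t \<in> A" "symmetric_op z" "symmetric_op t"
      "P o\<^sub>L z = z" "P o\<^sub>L t = t" "z o\<^sub>L t = P"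
      and zc: "\<And>v. \<bar>blinfun_apply z v \<bullet> v - blinfun_apply c v \<bullet> v\<bar> \<le> 2 * (\<beta>/8) * (norm v)\<^sup>2"
      using \<beta> E y(5)
      by (rule_tac schur_complement[OF P(1) cA(1) P(2) symc E(1) y(1) P(3) E(2) E(3)[OF P(1)] Pc
            y(2,3,4) _ _ _ near]) auto
    obtain R where R: "R \<in> A" "symmetric_op R" "R o\<^sub>L R = R" "R o\<^sub>L P = R"
      and Rpos: "\<And>v. blinfun_apply R v = v \<Longrightarrow> 0 \<le> blinfun_apply z v \<bullet> v"
      and Rneg: "\<And>v. R = 0 \<Longrightarrow> blinfun_apply z v \<bullet> v \<le> 0"
      using positive_spectral_projection[OF P(1) zt(1,2) P(2) zt(3,4) P(3) zt(5,6,7)] by metis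
    have "R \<noteq> 0"
    proof
      assume "R = 0"
      then have "blinfun_apply z v0 \<bullet> v0 \<le> 0" by (rule Rneg)
      moreover have "blinfun_apply c v0 \<bullet> v0 = blinfun_apply b v0 \<bullet> v0 - \<beta>/2 * (norm v0)\<^sup>2"
        by (simp add: c v0 inner_diff power2_norm_eq_inner)
      moreover have "\<beta> * (norm v0)\<^sup>2 > 0" using \<beta> v0(3) by simp
      ultimately show False using zc[of v0] bv0' by (simp add: abs_le_iff)
    qed
    have RQ: "v = 0" if "blinfun_apply R v = v" "blinfun_apply Q v = v" for v
    proof (rule ccontr)
      assume "v \<noteq> 0"
      have "blinfun_apply P v = v"
        using symmetric_compose_swap[OF R(2) P(2) R(2) R(4), THEN blinfun_compose_eqD, of v] that(1)
        by simp
      \<comment> \<open>As \<open>P v = Q v = v\<close>, the term \<open>b v\<close> vanishes and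
        only the shift remains.\<close>
      then have "blinfun_apply c v \<bullet> v = - (\<beta>/2) * (norm v)\<^sup>2"
        by (simp add: c b that(2) power2_norm_eq_inner)
      moreover have "\<beta> * (norm v)\<^sup>2 > 0" using \<beta> \<open>v \<noteq> 0\<close> by simp
      ultimately show False using zc[of v] Rpos[OF that(1)] by (simp add: abs_le_iff)
    qed
    have "is_proj_glb ip A R Q 0"
      unfolding is_proj_glb_def
    proof (intro conjI ballI impI)
      show "0 \<in> projections ip A" by (simp add: proj zero symmetric_op_def)
      fix S assume "S \<in> projections ip A" and S: "proj_le S R \<and> proj_le S Q"
      then have "symmetric_op S" by (simp add: proj)
      \<comment> \<open>By adjoints, \<open>R\<close> and \<open>Q\<close> fix every value of
        \<open>S\<close>, so \<open>RQ\<close> applies.\<close>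
      then have "R o\<^sub>L S = S" "Q o\<^sub>L S = S"
        using S symmetric_compose_swap R(2) Q(2) by (auto simp: proj_le_def)
      then have "blinfun_apply S v = 0" for v
        by (intro RQ blinfun_compose_eqD)
      then have "S = 0" by (intro blinfun_eqI) simp
      then show "proj_le S 0" by (simp add: proj_le_def)
    qed (simp_all add: proj_le_def)
    then show "\<exists>R\<in>projections ip A. R \<noteq> 0 \<and> proj_le R P \<and> is_proj_glb ip A R Q 0"
      using R \<open>R \<noteq> 0\<close> by (intro bexI[of _ R]) (auto simp: proj proj_le_def)
  qed
qed

end
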